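(* Let $(\Gamma^{\text{can}}_0,Q)$ represent a left-truncated one-dimensional exponential family. If its Shtarkov integral $$S=\int\sup_{\beta\in\Gamma^{\text{can}}_0}\frac{e^{\beta x}}{Z(\beta)}\,dQ(x)$$ is infinite, then its Jeffreys integral $$J=\int_{\Gamma^{\text{can}}_0}I_\beta^{1/2}\,d\beta$$ is infinite.
   Context: Exponential family. $Q$ is a nonzero $\sigma$-finite measure on $\mathbb{R}$, $Z(\beta)=\int e^{\beta x}\,dQ(x)$, $\Gamma^{\text{can}}=\{\beta\in\mathbb{R}: Z(\beta)<\infty\}$ (an interval), $\beta_{\sup}=\sup\Gamma^{\text{can}}$ and $\beta_{\inf}=\inf\Gamma^{\text{can}}$ (possibly infinite). For $\beta\in\Gamma^{\text{can}}$, $P_\beta$ is the probability measure with $\frac{dP_\beta}{dQ}(x)=\frac{1}{Z(\beta)}e^{\beta x}$. Left-truncated family. The pair $(\Gamma^{\text{can}}_0,Q)$ denotes the family $\{P_\beta:\beta\in\Gamma^{\text{can}}_0\}$, where $\Gamma^{\text{can}}_0=\{\beta\in\Gamma^{\text{can}}:\beta\ge b\}$ for some fixed $b$ with $\beta_{\inf}<b<\beta_{\sup}$. Fisher information. $I_\beta$ is the Fisher information in the canonical parametrization, i.e. the variance of $P_\beta$. The Shtarkov integral is the integral with respect to $Q$ of the maximized likelihood $\frac{1}{Z(\beta_x)}e^{\beta_x x}$, where $P_{\beta_x}$ is the maximum likelihood distribution for $x$ within the family. The integrand is taken to be the supremum of the likelihood also when it is not attained. *)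

theory Defs
  imports "HOL-Probability.Probability"
begin

definition partition_function :: "real measure \<Rightarrow> real \<Rightarrow> ennreal" where
  "partition_function Q \<beta> = (\<integral>\<^sup>+ x. ennreal (exp (\<beta> * x)) \<partial>Q)"

definition canonical_parameters :: "real measure \<Rightarrow> real set" where
  "canonical_parameters Q = {\<beta>. partition_function Q \<beta> < \<infinity>}"

definition beta_sup :: "real measure \<Rightarrow> ereal" where
  "beta_sup Q = (SUP \<beta>\<in>canonical_parameters Q. ereal \<beta>)"

definition beta_inf :: "real measure \<Rightarrow> ereal" where
  "beta_inf Q = (INF \<beta>\<in>canonical_parameters Q. ereal \<beta>)"

definition left_truncated_parameters :: "real measure \<Rightarrow> real \<Rightarrow> real set" where
  "left_truncated_parameters Q b = {\<beta> \<in> canonical_parameters Q. b \<le> \<beta>}"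

definition likelihood :: "real measure \<Rightarrow> real \<Rightarrow> real \<Rightarrow> ennreal" where
  "likelihood Q \<beta> x = ennreal (exp (\<beta> * x)) / partition_function Q \<beta>"

definition exp_family_measure :: "real measure \<Rightarrow> real \<Rightarrow> real measure" where
  "exp_family_measure Q \<beta> = density Q (likelihood Q \<beta>)"

text \<open>
  The variance below is the real-valued one and so has the default value 0 when the mean or
  the second moment is not finite. For a canonical parameter this can only happen at an
  endpoint of the parameter interval, hence on a Lebesgue null set.
\<close>
definition fisher_information :: "real measure \<Rightarrow> real \<Rightarrow> real" where
  "fisher_information Q \<beta> = prob_space.variance (exp_family_measure Q \<beta>) (\<lambda>x. x)"

definition shtarkov_integral :: "real set \<Rightarrow> real measure \<Rightarrow> ennreal" where
  "shtarkov_integral \<Gamma> Q = (\<integral>\<^sup>+ x. (SUP \<beta>\<in>\<Gamma>. likelihood Q \<beta> x) \<partial>Q)"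

definition jeffreys_integral :: "real set \<Rightarrow> real measure \<Rightarrow> ennreal" where
  "jeffreys_integral \<Gamma> Q = (\<integral>\<^sup>+ \<beta>\<in>\<Gamma>. ennreal (sqrt (fisher_information Q \<beta>)) \<partial>lborel)"

end

theory Submission
  imports Defs
begin

text \<open>
  In fact \<open>S \<le> 1 + J\<close>. The likelihood \<open>p\<^sub>t(x)\<close> has \<open>t\<close>-derivative \<open>(x - \<mu>\<^sub>t) p\<^sub>t(x)\<close>,
  where \<open>\<mu>\<^sub>t\<close> is the mean of \<open>P\<^sub>t\<close>, so every \<open>p\<^sub>\<beta>(x)\<close> with \<open>\<beta> \<ge> b\<close> is at most
  \<open>p\<^sub>b(x) + \<integral> \<bar>x - \<mu>\<^sub>t\<bar> p\<^sub>t(x) dt\<close>, the integral ranging over the whole truncated parameter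
  interval. Integrating this over \<open>x\<close> and exchanging the integrals leaves
  \<open>1 + \<integral> E\<^sub>t\<bar>X - \<mu>\<^sub>t\<bar> dt\<close>, and \<open>E\<^sub>t\<bar>X - \<mu>\<^sub>t\<bar> \<le> I\<^sub>t\<^sup>1\<^sup>/\<^sup>2\<close>.
\<close>

text \<open>The variance of the absolute deviation is nonnegative, and the second moment of that
  deviation is \<open>variance X\<close>.\<close>

lemma (in prob_space) expectation_abs_deviation_le:
  fixes X :: "'a \<Rightarrow> real"
  assumes [simp]: "integrable M X" "integrable M (\<lambda>x. (X x)\<^sup>2)"
  shows "expectation (\<lambda>x. \<bar>X x - expectation X\<bar>) \<le> sqrt (variance X)"
proof -
  let ?Y = "\<lambda>x. \<bar>X x - expectation X\<bar>"
  have Y2: "integrable M (\<lambda>x. (?Y x)\<^sup>2)"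
    by (simp add: power2_diff)
  have "variance ?Y = expectation (\<lambda>x. (?Y x)\<^sup>2) - (expectation ?Y)\<^sup>2"
    using Y2 by (intro variance_eq) auto
  then have "(expectation ?Y)\<^sup>2 \<le> variance X"
    using variance_positive[of ?Y] by simp
  then show ?thesis
    by (rule real_le_rsqrt)
qed

lemma exp_linear_remainder_le: "\<bar>exp y - 1 - y\<bar> \<le> exp \<bar>y\<bar> * y\<^sup>2" for y :: real
  using Taylor_exp_field[of y 1] by (simp add: diff_diff_eq numeral_2_eq_2)

section \<open>Moments and likelihoods as functions of the parameter\<close>

locale exponential_family = sigma_finite_measure Q for Q :: "real measure" +
  assumes sets_Q [measurable_cong, simp]: "sets Q = sets borel"
    and Q_nonzero: "emeasure Q (space Q) \<noteq> 0"
begin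

lemma space_Q [simp]: "space Q = UNIV"
  using sets_eq_imp_space_eq[OF sets_Q] by simp

abbreviation "\<Gamma> \<equiv> canonical_parameters Q"

text \<open>These moments are left unnormalised so that differentiating in \<open>t\<close> just
  raises \<open>k\<close>; \<open>moment 0\<close> is the real-valued Z. A divergent integral gets
  the value 0.\<close>

definition moment :: "nat \<Rightarrow> real \<Rightarrow> real" where
  "moment k t = (\<integral>x. x ^ k * exp (t * x) \<partial>Q)"

definition lik :: "real \<Rightarrow> real \<Rightarrow> real" where
  "lik t x = exp (t * x) / moment 0 t"

definition mean :: "real \<Rightarrow> real" where
  "mean t = moment 1 t / moment 0 t"

lemma mem_canonical_iff: "t \<in> \<Gamma> \<longleftrightarrow> integrable Q (\<lambda>x. exp (t * x))"
  by (simp add: canonical_parameters_def partition_function_def integrable_iff_bounded)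

lemma partition_function_eq_moment: "t \<in> \<Gamma> \<Longrightarrow> partition_function Q t = ennreal (moment 0 t)"
  by (simp add: partition_function_def moment_def mem_canonical_iff nn_integral_eq_integral)

text \<open>If Z(t) were 0, the positive function exp(t x) would vanish almost everywhere, which
  forces Q to be null.\<close>

lemma moment_0_pos:
  assumes "t \<in> \<Gamma>"
  shows "0 < moment 0 t"
proof (rule ccontr)
  assume "\<not> 0 < moment 0 t"
  then have "moment 0 t = 0"
    unfolding moment_def by (simp add: order_less_le)
  then have "AE x in Q. exp (t * x) = 0"
    using assms unfolding moment_def mem_canonical_iff
    by (subst (asm) integral_nonneg_eq_0_iff_AE) auto
  then have "AE x in Q. False"
    by simp
  then show False
    using Q_nonzero by (simp add: eventually_False ae_filter_eq_bot_iff)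
qed

lemma lik_nonneg: "t \<in> \<Gamma> \<Longrightarrow> 0 \<le> lik t x"
  using moment_0_pos[of t] by (simp add: lik_def)

lemma likelihood_eq_lik: "t \<in> \<Gamma> \<Longrightarrow> likelihood Q t x = ennreal (lik t x)"
  using moment_0_pos[of t]
  by (simp add: likelihood_def lik_def partition_function_eq_moment divide_ennreal)

text \<open>The exponent is at most c x for x \<ge> 0 and at most a x for x < 0, so one of the two
  summands suffices in each case.\<close>

lemma exp_mult_add_abs_le:
  fixes x :: real
  assumes "d \<le> t - a" "d \<le> c - t"
  shows "exp (t * x + d * \<bar>x\<bar>) \<le> exp (a * x) + exp (c * x)"
proof (cases "0 \<le> x")
  case True
  then have "t * x + d * \<bar>x\<bar> \<le> c * x"
    using mult_right_mono[of "t + d" c x] assms by (simp add: algebra_simps)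
  then show ?thesis
    by (simp add: add_increasing)
next
  case False
  then have "t * x + d * \<bar>x\<bar> \<le> a * x"
    using mult_right_mono_neg[of a "t - d" x] assms by (simp add: algebra_simps)
  then show ?thesis
    by (simp add: add_increasing2)
qed

text \<open>As \<open>r\<close> stays strictly below the distance from \<open>t\<close> to
  \<open>a\<close> and to \<open>c\<close>, an exponential factor is left over that absorbs the
  power. The weight exp(r |x|) makes room for varying the parameter around \<open>t\<close>.\<close>

lemma integrable_power_exp_abs:
  assumes ac: "a \<in> \<Gamma>" "c \<in> \<Gamma>" and r: "r < t - a" "r < c - t"
  shows "integrable Q (\<lambda>x. \<bar>x\<bar> ^ k * exp (t * x + r * \<bar>x\<bar>))"
proof -
  define d where "d = min (t - a) (c - t)"
  \<comment> \<open>Each of the \<open>k\<close> factors e |x| is at most exp(e |x|), and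
    \<open>k * e\<close> must fit into the slack \<open>d - r\<close>. Dividing by k + 1 also covers
    k = 0.\<close>
  define e where "e = (d - r) / (real k + 1)"
  have "r < d"
    using r by (simp add: d_def)
  then have e: "0 < e" "real k * e \<le> d - r"
    by (auto simp: e_def field_simps)
  have "\<bar>x\<bar> ^ k * exp (t * x + r * \<bar>x\<bar>) \<le> (exp (a * x) + exp (c * x)) / e ^ k" for x
  proof -
    have "(e * \<bar>x\<bar>) ^ k \<le> exp (e * \<bar>x\<bar>) ^ k"
      using e by (intro power_mono order_trans[OF _ exp_ge_add_one_self]) auto
    also have "\<dots> = exp (real k * e * \<bar>x\<bar>)"
      by (simp add: exp_of_nat_mult mult.assoc)
    also have "\<dots> \<le> exp ((d - r) * \<bar>x\<bar>)"
      using e by (simp add: mult_right_mono)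
    finally have "e ^ k * \<bar>x\<bar> ^ k * exp (t * x + r * \<bar>x\<bar>)
        \<le> exp ((d - r) * \<bar>x\<bar>) * exp (t * x + r * \<bar>x\<bar>)"
      by (simp add: power_mult_distrib)
    also have "\<dots> = exp (t * x + d * \<bar>x\<bar>)"
      by (simp add: exp_add[symmetric] algebra_simps)
    also have "\<dots> \<le> exp (a * x) + exp (c * x)"
      by (rule exp_mult_add_abs_le) (auto simp: d_def)
    finally show ?thesis
      using e by (simp add: field_simps)
  qed
  then have bound: "norm (\<bar>x\<bar> ^ k * exp (t * x + r * \<bar>x\<bar>))
      \<le> norm ((exp (a * x) + exp (c * x)) / e ^ k)" for x
    using e by simp
  have "integrable Q (\<lambda>x. (exp (a * x) + exp (c * x)) / e ^ k)"
    using ac by (simp add: mem_canonical_iff)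
  then show ?thesis
    by (rule Bochner_Integration.integrable_bound) (measurable, rule AE_I2, rule bound)
qed

lemma integrable_power_exp:
  assumes "a \<in> \<Gamma>" "c \<in> \<Gamma>" "a < t" "t < c"
  shows "integrable Q (\<lambda>x. x ^ k * exp (t * x))"
  using integrable_power_exp_abs[of a c 0 t k] assms
  by (subst integrable_norm_iff[symmetric]) (auto simp: abs_mult power_abs)

lemma canonical_interval:
  assumes "a \<in> \<Gamma>" "c \<in> \<Gamma>" "a \<le> t" "t \<le> c"
  shows "t \<in> \<Gamma>"
  using assms integrable_power_exp[of a c t 0]
  by (cases "t = a \<or> t = c") (auto simp: mem_canonical_iff)

text \<open>Differentiation under the integral sign: for |h| < r the second-order Taylor remainder
  of exp(h x) is at most h^2 x^2 exp(r |x|), which has finite integral against |x|^k exp(t x). Hence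
  the difference quotient is off by at most K |h|.\<close>

lemma DERIV_moment:
  assumes ac: "a \<in> \<Gamma>" "c \<in> \<Gamma>" "a < t" "t < c"
  shows "(moment k has_real_derivative moment (Suc k) t) (at t)"
proof -
  define r where "r = min (t - a) (c - t) / 2"
  have r: "0 < r" "r < t - a" "r < c - t"
    using ac by (auto simp: r_def min_def field_simps)
  define K where "K = (\<integral>x. \<bar>x\<bar> ^ (k + 2) * exp (t * x + r * \<bar>x\<bar>) \<partial>Q)"
  have quot: "\<bar>(moment k (t + h) - moment k t) / h - moment (Suc k) t\<bar> \<le> K * \<bar>h\<bar>"
    if h: "h \<noteq> 0" "\<bar>h\<bar> < r" for h
  proof -
    have i: "integrable Q (\<lambda>x. x ^ j * exp (s * x))" if "a < s" "s < c" for j s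
      using ac that by (intro integrable_power_exp)
    have th: "a < t + h" "t + h < c"
      using h r by auto
    let ?R = "\<lambda>x. x ^ k * exp ((t + h) * x) - x ^ k * exp (t * x) - h * (x ^ Suc k * exp (t * x))"
    have R: "moment k (t + h) - moment k t - h * moment (Suc k) t = (\<integral>x. ?R x \<partial>Q)"
      unfolding moment_def using i[OF th, of k] i[of t k] i[of t "Suc k"] ac
      by (simp del: power_Suc)
    have bound: "norm (?R x) \<le> h\<^sup>2 * (\<bar>x\<bar> ^ (k + 2) * exp (t * x + r * \<bar>x\<bar>))" for x
    proof -
      have "?R x = x ^ k * exp (t * x) * (exp (h * x) - 1 - h * x)"
        by (simp add: algebra_simps exp_add)
      then have "norm (?R x) = \<bar>x\<bar> ^ k * exp (t * x) * \<bar>exp (h * x) - 1 - h * x\<bar>"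
        by (simp add: abs_mult power_abs)
      also have "\<dots> \<le> \<bar>x\<bar> ^ k * exp (t * x) * (exp (r * \<bar>x\<bar>) * (h * x)\<^sup>2)"
      proof (intro mult_left_mono order_trans[OF exp_linear_remainder_le] mult_right_mono)
        show "exp \<bar>h * x\<bar> \<le> exp (r * \<bar>x\<bar>)"
          using h by (simp add: abs_mult mult_right_mono)
      qed auto
      also have "\<dots> = h\<^sup>2 * (\<bar>x\<bar> ^ (k + 2) * exp (t * x + r * \<bar>x\<bar>))"
        by (simp add: exp_add power_add power_mult_distrib power2_eq_square mult_ac)
      finally show ?thesis .
    qed
    have "norm (\<integral>x. ?R x \<partial>Q) \<le> (\<integral>x. h\<^sup>2 * (\<bar>x\<bar> ^ (k + 2) * exp (t * x + r * \<bar>x\<bar>)) \<partial>Q)"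
      by (intro Bochner_Integration.integral_norm_bound_integral bound Bochner_Integration.integrable_diff
          integrable_mult_right i th ac integrable_power_exp_abs[OF ac(1,2) r(2,3)])
    also have "\<dots> = h\<^sup>2 * K"
      by (simp add: K_def)
    finally have "\<bar>moment k (t + h) - moment k t - h * moment (Suc k) t\<bar> / \<bar>h\<bar> \<le> h\<^sup>2 * K / \<bar>h\<bar>"
      unfolding R[symmetric] by (intro divide_right_mono) auto
    moreover have "(moment k (t + h) - moment k t - h * moment (Suc k) t) / h
        = (moment k (t + h) - moment k t) / h - moment (Suc k) t"
      using h by (simp add: field_simps)
    moreover have "h\<^sup>2 * K / \<bar>h\<bar> = K * \<bar>h\<bar>"
      using h by (cases "0 < h") (auto simp: power2_eq_square)
    ultimately show ?thesis
      by (metis abs_divide)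
  qed
  have "(\<lambda>h. (moment k (t + h) - moment k t) / h - moment (Suc k) t) \<midarrow>0\<rightarrow> 0"
  proof (rule Lim_null_comparison)
    show "eventually (\<lambda>h. norm ((moment k (t + h) - moment k t) / h - moment (Suc k) t) \<le> K * \<bar>h\<bar>) (at 0)"
      unfolding eventually_at using quot r(1) by (auto simp: dist_real_def)
    show "((\<lambda>h. K * \<bar>h\<bar>) \<longlongrightarrow> 0) (at 0)"
      by (auto intro!: tendsto_eq_intros)
  qed
  then show ?thesis
    unfolding DERIV_def by (rule LIM_zero_cancel)
qed

lemma DERIV_lik:
  assumes "a \<in> \<Gamma>" "c \<in> \<Gamma>" "a < t" "t < c"
  shows "((\<lambda>t. lik t x) has_real_derivative (x - mean t) * lik t x) (at t)"
proof -
  have "moment 0 t \<noteq> 0"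
    using assms moment_0_pos[OF canonical_interval[of a c t]] by simp
  then show ?thesis
    unfolding lik_def mean_def
    using DERIV_moment[OF assms, of 0]
    by (auto intro!: derivative_eq_intros simp: field_simps)
qed

text \<open>Measurability in the parameter is needed for exchanging the integrals. Thanks to the
  default value 0 it holds on the whole line, not just on \<Gamma>.\<close>

lemma moment_measurable [measurable]:
  assumes [measurable]: "f \<in> borel_measurable M"
  shows "(\<lambda>x. moment k (f x)) \<in> borel_measurable M"
  unfolding moment_def by measurable

lemma mean_measurable [measurable]:
  assumes [measurable]: "f \<in> borel_measurable M"
  shows "(\<lambda>x. mean (f x)) \<in> borel_measurable M"
  unfolding mean_def by measurable

lemma lik_measurable [measurable]:
  assumes [measurable]: "f \<in> borel_measurable M" "g \<in> borel_measurable M"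
  shows "(\<lambda>x. lik (f x) (g x)) \<in> borel_measurable M"
  unfolding lik_def by measurable

section \<open>The probability measures of the family and their mean absolute deviation\<close>

lemma nn_integral_lik:
  assumes "t \<in> \<Gamma>"
  shows "(\<integral>\<^sup>+ x. lik t x \<partial>Q) = 1"
proof -
  have "integrable Q (\<lambda>x. lik t x)"
    using assms by (simp add: lik_def mem_canonical_iff)
  then have "(\<integral>\<^sup>+ x. lik t x \<partial>Q) = ennreal (\<integral>x. lik t x \<partial>Q)"
    using assms by (intro nn_integral_eq_integral) (auto simp: lik_nonneg)
  also have "(\<integral>x. lik t x \<partial>Q) = 1"
    using moment_0_pos[OF assms] by (simp add: lik_def moment_def)
  finally show ?thesis
    by simp
qed

lemma exp_family_measure_eq:
  "t \<in> \<Gamma> \<Longrightarrow> exp_family_measure Q t = density Q (\<lambda>x. ennreal (lik t x))"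
  unfolding exp_family_measure_def by (rule arg_cong[where f = "density Q"]) (auto simp: likelihood_eq_lik)

lemma prob_space_exp_family_measure:
  assumes "t \<in> \<Gamma>"
  shows "prob_space (exp_family_measure Q t)"
  using nn_integral_lik[OF assms]
  by (intro prob_spaceI) (simp add: exp_family_measure_eq[OF assms] emeasure_density cong: nn_integral_cong)

text \<open>At an interior parameter all moments are finite, so \<open>fisher_information\<close> is
  the true variance there and the bound by the standard deviation applies.\<close>

lemma nn_integral_abs_deviation_le:
  assumes ac: "a \<in> \<Gamma>" "c \<in> \<Gamma>" "a < t" "t < c"
  shows "(\<integral>\<^sup>+ x. ennreal (\<bar>x - mean t\<bar> * lik t x) \<partial>Q) \<le> ennreal (sqrt (fisher_information Q t))"
proof -
  have t: "t \<in> \<Gamma>"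
    using canonical_interval[of a c t] ac by simp
  let ?P = "exp_family_measure Q t"
  interpret P: prob_space ?P
    by (rule prob_space_exp_family_measure[OF t])
  have intP: "integrable ?P f \<longleftrightarrow> integrable Q (\<lambda>x. lik t x * f x)"
    and integralP: "(\<integral>x. f x \<partial>?P) = (\<integral>x. lik t x * f x \<partial>Q)"
    if "f \<in> borel_measurable borel" for f :: "real \<Rightarrow> real"
    using that t by (auto simp: exp_family_measure_eq integrable_density integral_density lik_nonneg)
  have power: "integrable ?P (\<lambda>x. x ^ k)" for k
    using integrable_power_exp[OF ac, of k]
    by (subst intP) (auto simp: lik_def mult.commute)
  have mean: "P.expectation (\<lambda>x. x) = mean t"
    by (subst integralP) (auto simp: lik_def mean_def moment_def mult.commute)
  have "integrable ?P (\<lambda>x. \<bar>x - mean t\<bar>)"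
    using power[of 1]
    by (intro integrable_abs Bochner_Integration.integrable_diff P.integrable_const) simp
  then have "integrable Q (\<lambda>x. lik t x * \<bar>x - mean t\<bar>)"
    by (rule iffD1[OF intP, rotated]) measurable
  then have "(\<integral>\<^sup>+ x. ennreal (lik t x * \<bar>x - mean t\<bar>) \<partial>Q)
      = ennreal (\<integral>x. lik t x * \<bar>x - mean t\<bar> \<partial>Q)"
    using t by (intro nn_integral_eq_integral) (auto simp: lik_nonneg)
  also have "(\<integral>x. lik t x * \<bar>x - mean t\<bar> \<partial>Q) = P.expectation (\<lambda>x. \<bar>x - mean t\<bar>)"
    by (rule integralP[symmetric]) measurable
  also have "\<dots> \<le> ennreal (sqrt (fisher_information Q t))"
    unfolding fisher_information_def
    using P.expectation_abs_deviation_le[of "\<lambda>x. x"] power[of 1] power[of 2]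
    by (intro ennreal_leI) (simp add: mean)
  finally show ?thesis
    by (simp add: mult.commute)
qed

section \<open>Pointwise bounds on the likelihood\<close>

lemma lik_le_integral:
  assumes ac: "a \<in> \<Gamma>" "c \<in> \<Gamma>" "a < b" "b \<le> t" "t < c"
  shows "ennreal (lik t x)
    \<le> ennreal (lik b x) + (\<integral>\<^sup>+ s\<in>{b..t}. ennreal (\<bar>x - mean s\<bar> * lik s x) \<partial>lborel)"
proof -
  let ?f = "\<lambda>s. (x - mean s) * lik s x"
  have s: "s \<in> \<Gamma>" if "s \<in> {b..t}" for s
    using canonical_interval[of a c s] ac that by auto
  have "continuous_on {b..t} (moment k)" for k
    using ac by (intro DERIV_continuous_on[where D = "moment (Suc k)"])
      (auto intro!: has_field_derivative_at_within[OF DERIV_moment[OF ac(1,2)]])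
  moreover have "moment 0 s \<noteq> 0" if "s \<in> {b..t}" for s
    using moment_0_pos[OF s[OF that]] by simp
  ultimately have cont: "continuous_on {b..t} ?f"
    unfolding lik_def mean_def by (intro continuous_intros) auto
  have int: "integrable lborel (\<lambda>s. indicator {b..t} s *\<^sub>R ?f s)"
    using borel_integrable_atLeastAtMost'[OF cont] by (simp add: set_integrable_def)
  \<comment> \<open>Fundamental theorem of calculus in the parameter. Since a < b and t < c, the
    closed interval from b to t lies in the interior of \<Gamma>, so the derivative exists at both
    ends too.\<close>
  have "lik t x - lik b x = (\<integral>s. indicator {b..t} s *\<^sub>R ?f s \<partial>lborel)"
    using ac cont
    by (intro integral_FTC_atLeastAtMost[symmetric])
      (auto simp: has_real_derivative_iff_has_vector_derivative[symmetric]
        intro!: has_field_derivative_at_within[OF DERIV_lik[OF ac(1,2)]])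
  also have "\<dots> \<le> (\<integral>s. norm (indicator {b..t} s *\<^sub>R ?f s) \<partial>lborel)"
    using int by (intro integral_mono) auto
  finally have "ennreal (lik t x)
      \<le> ennreal (lik b x + (\<integral>s. norm (indicator {b..t} s *\<^sub>R ?f s) \<partial>lborel))"
    by (intro ennreal_leI) simp
  also have "\<dots> = ennreal (lik b x) + ennreal (\<integral>s. norm (indicator {b..t} s *\<^sub>R ?f s) \<partial>lborel)"
    using s[of b] ac by (intro ennreal_plus lik_nonneg) auto
  also have "ennreal (\<integral>s. norm (indicator {b..t} s *\<^sub>R ?f s) \<partial>lborel)
      = (\<integral>\<^sup>+ s. norm (indicator {b..t} s *\<^sub>R ?f s) \<partial>lborel)"
    using int by (intro nn_integral_eq_integral[symmetric]) auto
  also have "\<dots> = (\<integral>\<^sup>+ s\<in>{b..t}. ennreal (\<bar>x - mean s\<bar> * lik s x) \<partial>lborel)"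
    using lik_nonneg[OF s] by (intro nn_integral_cong) (auto simp: indicator_def abs_mult)
  finally show ?thesis .
qed

text \<open>
  At a finite right endpoint of \<open>\<Gamma>\<close> the partition function need not be differentiable;
  its convexity suffices to carry a bound over to the endpoint.
\<close>
lemma lik_le_limit:
  assumes bc: "b \<in> \<Gamma>" "c \<in> \<Gamma>" "b < c"
    and le: "\<And>t. b \<le> t \<Longrightarrow> t < c \<Longrightarrow> lik t x \<le> B"
  shows "lik c x \<le> B"
proof -
  have B: "0 \<le> B"
    using le[of b] bc lik_nonneg[of b x] by simp
  \<comment> \<open>The assumed bound is multiplied out by Z, and Z is then replaced by its chord
    from \<open>b\<close> to \<open>c\<close>, which lies above it. Both sides are now explicit
    continuous functions of \<open>s\<close>, so s can tend to 1.\<close>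
  have *: "exp ((b + s * (c - b)) * x) \<le> B * ((1 - s) * moment 0 b + s * moment 0 c)"
    if s: "0 < s" "s < 1" for s
  proof -
    let ?t = "b + s * (c - b)"
    have "?t < b + 1 * (c - b)"
      using s bc by (intro add_strict_left_mono mult_strict_right_mono) auto
    then have "?t < c"
      by simp
    moreover have "b \<le> ?t"
      using s bc by simp
    ultimately have t: "b \<le> ?t" "?t < c"
      by blast+
    then have G: "?t \<in> \<Gamma>"
      using canonical_interval[of b c ?t] bc by simp
    have "exp (?t * y) \<le> (1 - s) * exp (b * y) + s * exp (c * y)" for y
      using convex_onD[OF exp_convex, of s "b * y" "c * y"] s by (simp add: algebra_simps)
    then have "moment 0 ?t \<le> (\<integral>y. (1 - s) * exp (b * y) + s * exp (c * y) \<partial>Q)"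
      unfolding moment_def power_0 mult_1 using G bc
      by (intro integral_mono) (auto simp: mem_canonical_iff)
    also have "\<dots> = (1 - s) * moment 0 b + s * moment 0 c"
      using bc by (simp add: moment_def mem_canonical_iff)
    finally have "B * moment 0 ?t \<le> B * ((1 - s) * moment 0 b + s * moment 0 c)"
      using B by (intro mult_left_mono)
    moreover have "exp (?t * x) \<le> B * moment 0 ?t"
      using le[OF t] moment_0_pos[OF G] by (simp add: lik_def field_simps)
    ultimately show ?thesis
      by simp
  qed
  have "exp ((b + 1 * (c - b)) * x) \<le> B * ((1 - 1) * moment 0 b + 1 * moment 0 c)"
  proof (rule tendsto_le)
    show "((\<lambda>s. exp ((b + s * (c - b)) * x)) \<longlongrightarrow> exp ((b + 1 * (c - b)) * x)) (at_left 1)"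
      by (intro tendsto_intros)
    show "((\<lambda>s. B * ((1 - s) * moment 0 b + s * moment 0 c))
        \<longlongrightarrow> B * ((1 - 1) * moment 0 b + 1 * moment 0 c)) (at_left 1)"
      by (intro tendsto_intros)
    show "eventually (\<lambda>s. exp ((b + s * (c - b)) * x)
        \<le> B * ((1 - s) * moment 0 b + s * moment 0 c)) (at_left 1)"
      using eventually_at_left_real[of 0 "1::real"] by (rule eventually_mono) (use * in auto)
  qed simp
  then show ?thesis
    using moment_0_pos[OF bc(2)] by (simp add: lik_def field_simps)
qed

section \<open>The inequality S \<le> 1 + J\<close>

lemma shtarkov_le_one_plus_jeffreys:
  assumes a: "a \<in> \<Gamma>" "a < b" and c: "c \<in> \<Gamma>" "b < c"
  shows "shtarkov_integral (left_truncated_parameters Q b) Q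
    \<le> 1 + jeffreys_integral (left_truncated_parameters Q b) Q"
proof -
  \<comment> \<open>This is the truncated parameter set without its largest element, if it has one.
    Each of its points lies strictly between \<open>a\<close> and some element of \<Gamma>, and the
    form as a closed set meeting an open one makes it Borel.\<close>
  define G where "G = {b..} \<inter> (\<Union>u\<in>\<Gamma>. {..<u})"
  have [measurable]: "G \<in> sets borel"
    unfolding G_def by (intro sets.Int borel_closed borel_open open_UN) auto
  have b: "b \<in> \<Gamma>"
    using canonical_interval[of a c b] a c by simp
  have G: "\<exists>u\<in>\<Gamma>. a < t \<and> t < u" "t \<in> \<Gamma>" "b \<le> t" if "t \<in> G" for t
    using that a canonical_interval[OF a(1), of _ t] by (force simp: G_def)+
  define g where "g t x = ennreal (\<bar>x - mean t\<bar> * lik t x) * indicator G t" for t x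
  have [measurable]: "case_prod g \<in> borel_measurable (lborel \<Otimes>\<^sub>M Q)"
    unfolding g_def by measurable
  \<comment> \<open>Enlarging the integral from \<open>{b..t}\<close> to \<open>G\<close> makes the
    bound independent of \<open>t\<close>, so that it survives the supremum.\<close>
  have inner: "ennreal (lik t x) \<le> ennreal (lik b x) + (\<integral>\<^sup>+ s. g s x \<partial>lborel)" if tG: "t \<in> G" for t x
  proof -
    obtain u where u: "u \<in> \<Gamma>" "t < u"
      using tG by (auto simp: G_def)
    have "ennreal (lik t x)
        \<le> ennreal (lik b x) + (\<integral>\<^sup>+ s\<in>{b..t}. ennreal (\<bar>x - mean s\<bar> * lik s x) \<partial>lborel)"
      using tG a u by (intro lik_le_integral[of a u]) (auto simp: G_def)
    also have "\<dots> \<le> ennreal (lik b x) + (\<integral>\<^sup>+ s. g s x \<partial>lborel)"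
      using u by (intro add_left_mono nn_integral_mono) (auto simp: g_def G_def indicator_def)
    finally show ?thesis .
  qed
  have pointwise: "likelihood Q t x \<le> ennreal (lik b x) + (\<integral>\<^sup>+ s. g s x \<partial>lborel)"
    if t: "t \<in> left_truncated_parameters Q b" for t x
  proof (cases "t \<in> G")
    case True
    then show ?thesis
      using inner t by (simp add: likelihood_eq_lik left_truncated_parameters_def)
  next
    \<comment> \<open>Here \<open>t\<close> is the largest element of \<Gamma>. It differs from
      \<open>b\<close> because of \<open>c\<close>, and every s with b \<le> s < t lies in
      \<open>G\<close>, so the bound carries over to \<open>t\<close> by a limit.\<close>
    case False
    have t: "t \<in> \<Gamma>" "b \<le> t"
      using t by (auto simp: left_truncated_parameters_def)
    then have bt: "b < t"
      using False c by (force simp: G_def)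
    show ?thesis
    proof (cases "ennreal (lik b x) + (\<integral>\<^sup>+ s. g s x \<partial>lborel)")
      case (real B)
      have "lik t x \<le> B"
      proof (rule lik_le_limit[OF b t(1) bt])
        fix s assume "b \<le> s" "s < t"
        then show "lik s x \<le> B"
          using inner[of s x] t(1) real by (auto simp: G_def ennreal_le_iff)
      qed
      then show ?thesis
        using t real by (simp add: likelihood_eq_lik ennreal_leI)
    qed simp
  qed
  interpret lborel_Q: pair_sigma_finite lborel Q ..
  have "shtarkov_integral (left_truncated_parameters Q b) Q
      \<le> (\<integral>\<^sup>+ x. ennreal (lik b x) + (\<integral>\<^sup>+ s. g s x \<partial>lborel) \<partial>Q)"
    unfolding shtarkov_integral_def by (intro nn_integral_mono SUP_least pointwise)
  also have "\<dots> = (\<integral>\<^sup>+ x. ennreal (lik b x) \<partial>Q) + (\<integral>\<^sup>+ x. \<integral>\<^sup>+ s. g s x \<partial>lborel \<partial>Q)"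
    by (intro nn_integral_add) measurable
  also have "\<dots> = 1 + (\<integral>\<^sup>+ s. \<integral>\<^sup>+ x. g s x \<partial>Q \<partial>lborel)"
    by (simp add: nn_integral_lik[OF b] lborel_Q.Fubini')
  also have "(\<integral>\<^sup>+ s. \<integral>\<^sup>+ x. g s x \<partial>Q \<partial>lborel)
      \<le> jeffreys_integral (left_truncated_parameters Q b) Q"
    unfolding jeffreys_integral_def
  proof (rule nn_integral_mono)
    fix s :: real
    \<comment> \<open>Outside \<open>G\<close> the left side is 0, so a default value of the
      variance at the right endpoint does no harm.\<close>
    show "(\<integral>\<^sup>+ x. g s x \<partial>Q) \<le> ennreal (sqrt (fisher_information Q s))
        * indicator (left_truncated_parameters Q b) s"
      using G[of s] nn_integral_abs_deviation_le[OF a(1), of _ s]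
      by (cases "s \<in> G") (auto simp: g_def left_truncated_parameters_def)
  qed
  finally show ?thesis
    by (simp add: add_left_mono)
qed

end

theorem theorem2:
  fixes Q :: "real measure" and b :: real
  assumes "sets Q = sets borel"
    and "sigma_finite_measure Q"
    and "emeasure Q (space Q) \<noteq> 0"
    and "beta_inf Q < ereal b"
    and "ereal b < beta_sup Q"
    and "shtarkov_integral (left_truncated_parameters Q b) Q = \<infinity>"
  shows "jeffreys_integral (left_truncated_parameters Q b) Q = \<infinity>"
proof -
  have "exponential_family Q"
    using assms(1-3) by (intro exponential_family.intro exponential_family_axioms.intro)
  moreover obtain a c where "a \<in> canonical_parameters Q" "a < b" "c \<in> canonical_parameters Q" "b < c"
    using assms(4,5) by (auto simp: beta_inf_def beta_sup_def INF_less_iff less_SUP_iff)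
  ultimately show ?thesis
    using exponential_family.shtarkov_le_one_plus_jeffreys[of Q a b c] assms(6)
    by (simp add: top_unique)
qed

end
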